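(* Let $n \geq 3$ and let $X$ be a real $n$-dimensional normed space which possesses an $(n-1)$-dimensional subspace $Y$ such that $\lambda(Y, X) = 2 - \frac{2}{n}$. Then $X$ possesses also a two-dimensional subspace $Z$ such that $\lambda(Z, X)=1$.
   Context: All normed spaces are real. For a subspace $Y$ of a normed space $X$, a projection from $X$ onto $Y$ is a bounded linear operator $P: X \to Y$ with $P|_Y = \mathrm{Id}_Y$; the relative projection constant $\lambda(Y,X)$ is the infimum of $\|P\|$ over all projections $P$ from $X$ onto $Y$. *)

theory Defs
  imports "HOL-Analysis.Analysis"
begin

definition is_projection_onto :: "('a::real_normed_vector \<Rightarrow> 'a) \<Rightarrow> 'a set \<Rightarrow> bool"
  where "is_projection_onto P Y \<longleftrightarrow>
    bounded_linear P \<and> range P \<subseteq> Y \<and> (\<forall>y\<in>Y. P y = y)"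

text \<open>
  The ambient space is the whole type, so \<open>rel_proj_const Y\<close> is $\lambda(Y, X)$ with $X$ the
  universe of the type \<open>'a\<close>. The infimum is taken in the reals: operator norms are
  bounded below by 0, but the value is meaningful only if \<open>Y\<close> admits a projection, which is always
  the case for a finite-dimensional subspace \<open>Y\<close>.
\<close>

definition rel_proj_const :: "'a::real_normed_vector set \<Rightarrow> real"
  where "rel_proj_const Y = (INF P\<in>{P. is_projection_onto P Y}. onorm P)"

end

theory Submission
  imports Defs
begin

text \<open>
  Write \<open>Y\<close> as the kernel of a functional \<open>f\<close>, and call \<open>f x\<close> the height of \<open>x\<close>. The projections
  onto \<open>Y\<close> are the maps \<open>x \<mapsto> x - f x *\<^sub>R w\<close> with \<open>w\<close> of height 1. That \<open>2 - 2 / n\<close> is the largest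
  possible projection constant of a hyperplane is a theorem of Bohnenblust; the proof below follows
  a geometric version of it and reads off what happens in the case of equality.

  Since \<open>w\<close> varies in a space of dimension \<open>n - 1\<close>, Helly's theorem and compactness yield \<open>n\<close> points
  \<open>x i\<close> of the unit ball such that every projection moves one of them to a point of norm at least
  \<open>2 - 2 / n\<close> (lemma \<open>extremal_tuple\<close>). Testing this with vectors \<open>w\<close> that are nonnegative
  combinations of the \<open>x i\<close> forces all the \<open>x i\<close> to have the same height (lemma
  \<open>equal_heights_of_unbalanced\<close>). The points then lie in a translate of \<open>Y\<close>, no point of their convex
  hull has distance less than \<open>2 - 2 / n\<close> from all of them, and this rigidity yields two of them,
  \<open>u\<close> and \<open>v\<close>, with \<open>norm (u + v) = norm (u - v) = 2\<close> (lemma \<open>long_sum_and_difference\<close>). The plane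
  spanned by \<open>u\<close> and \<open>v\<close> has a parallelogram with vertices \<open>u\<close>, \<open>v\<close>, \<open>-u\<close>, \<open>-v\<close> as its unit ball, so
  it is isometric to the plane with the maximum norm and therefore the image of a projection of norm 1
  (lemma \<open>one_complemented_plane\<close>), the two coordinates being extended by the Hahn-Banach theorem,
  here for finite-dimensional spaces (lemma \<open>norming_functional_finite_dim\<close>).
\<close>

section \<open>Finite-dimensional normed spaces\<close>

lemma compact_functions_into_compact:
  fixes S :: "'b::topological_space set"
  assumes "compact S"
  shows "compact {c :: 'i \<Rightarrow> 'b. \<forall>i. c i \<in> S}"
proof -
  have "compactin (product_topology (\<lambda>_::'i. euclidean) UNIV) (PiE UNIV (\<lambda>_. S))"
    using assms by (simp add: compactin_PiE)
  moreover have "PiE UNIV (\<lambda>_. S) = {c :: 'i \<Rightarrow> 'b. \<forall>i. c i \<in> S}"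
    by auto
  ultimately show ?thesis
    by (simp add: euclidean_product_topology)
qed

lemma continuous_on_linear_combination:
  fixes b :: "'i \<Rightarrow> 'a::real_normed_vector"
  shows "continuous_on C (\<lambda>c :: 'i \<Rightarrow> real. \<Sum>i\<in>I. c i *\<^sub>R b i)"
  by (intro continuous_intros continuous_on_subset[OF continuous_on_product_coordinates]) auto

text \<open>
  Any norm dominates the coordinates: on the compact sphere of the maximum norm of the coordinate
  space, the norm of the linear combination is continuous and never 0, so it has a positive
  minimum \<open>m\<close>; homogeneity does the rest.
\<close>

lemma coordinates_bounded:
  fixes B :: "'a::real_normed_vector set"
  assumes fin: "finite B" and ind: "independent B" and span: "span B = UNIV"
  obtains m where "m > 0" "\<And>x b. b \<in> B \<Longrightarrow> m * \<bar>representation B x b\<bar> \<le> norm x"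
proof -
  define T where "T c = (\<Sum>b\<in>B. c b *\<^sub>R b)" for c :: "'a \<Rightarrow> real"
  define S where "S = (\<Union>b\<in>B. {c :: 'a \<Rightarrow> real. \<forall>i. c i \<in> {-1..1}} \<inter> {c. \<bar>c b\<bar> = 1})"
  have cl: "closed {c :: 'a \<Rightarrow> real. \<bar>c b\<bar> = 1}" for b
    by (intro closed_Collect_eq continuous_intros continuous_on_product_coordinates)
  have "compact S"
    unfolding S_def by (intro compact_UN fin compact_Int_closed cl compact_functions_into_compact) auto
  have cont: "continuous_on S (\<lambda>c. norm (T c))"
    unfolding T_def by (intro continuous_on_norm continuous_on_linear_combination)
  have pos: "norm (T c) > 0" if "c \<in> S" for c
  proof -
    from that obtain b where "b \<in> B" "c b \<noteq> 0"
      by (auto simp: S_def)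
    then have "T c \<noteq> 0"
      using ind fin independentD[of B B c b] by (auto simp: T_def)
    then show ?thesis by simp
  qed
  obtain m where m: "m > 0" "\<And>c. c \<in> S \<Longrightarrow> m \<le> norm (T c)"
  proof (cases "S = {}")
    case True
    then show ?thesis using that[of 1] by auto
  next
    case False
    then obtain c0 where "c0 \<in> S" "\<forall>c\<in>S. norm (T c0) \<le> norm (T c)"
      using continuous_attains_inf[OF \<open>compact S\<close> False cont] by blast
    then show ?thesis using that[of "norm (T c0)"] pos by auto
  qed
  have "m * \<bar>representation B x b\<bar> \<le> norm x" if "b \<in> B" for x b
  proof -
    let ?c = "representation B x"
    define M where "M = Max ((\<lambda>b. \<bar>?c b\<bar>) ` B)"
    have le: "\<bar>?c b'\<bar> \<le> M" if "b' \<in> B" for b'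
      using that fin by (simp add: M_def)
    have "M \<in> (\<lambda>b. \<bar>?c b\<bar>) ` B"
      unfolding M_def using fin \<open>b \<in> B\<close> by (intro Max_in) auto
    then obtain b1 where b1: "b1 \<in> B" "\<bar>?c b1\<bar> = M" by auto
    have Tx: "T ?c = x"
      using sum_representation_eq[OF ind _ fin subset_refl, of x] span by (simp add: T_def)
    show ?thesis
    proof (cases "M = 0")
      case True
      with le[OF \<open>b \<in> B\<close>] show ?thesis by simp
    next
      case False
      then have "M > 0" using b1 by auto
      define c where "c b = (if b \<in> B then ?c b / M else 0)" for b
      have "\<bar>c i\<bar> \<le> 1" for i
        using le[of i] \<open>M > 0\<close> by (auto simp: c_def)
      then have "c i \<in> {-1..1}" for i
        by (metis abs_le_iff atLeastAtMost_iff minus_le_iff)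
      moreover have "\<bar>c b1\<bar> = 1"
        using b1 \<open>M > 0\<close> by (simp add: c_def)
      ultimately have "c \<in> S"
        using b1(1) by (auto simp: S_def)
      have "T c = (1 / M) *\<^sub>R T ?c"
        by (simp add: T_def c_def scaleR_sum_right)
      then have "m \<le> norm x / M"
        using m(2)[OF \<open>c \<in> S\<close>] Tx \<open>M > 0\<close> by simp
      then have "m * M \<le> norm x"
        using \<open>M > 0\<close> by (simp add: field_simps)
      moreover have "m * \<bar>?c b\<bar> \<le> m * M"
        using le[OF \<open>b \<in> B\<close>] m(1) by simp
      ultimately show ?thesis by linarith
    qed
  qed
  with m(1) show ?thesis using that by blast
qed

lemma compact_cball_finite_dim:
  fixes B :: "'a::real_normed_vector set"
  assumes fin: "finite B" and ind: "independent B" and span: "span B = UNIV"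
  shows "compact (cball (0::'a) r)"
proof -
  obtain m where m: "m > 0" "\<And>x b. b \<in> B \<Longrightarrow> m * \<bar>representation B x b\<bar> \<le> norm x"
    using coordinates_bounded[OF assms] by blast
  define T where "T c = (\<Sum>b\<in>B. c b *\<^sub>R b)" for c :: "'a \<Rightarrow> real"
  define R where "R = \<bar>r\<bar> / m"
  have comp: "compact (T ` {c. \<forall>i. c i \<in> {-R..R}})"
    unfolding T_def
    by (intro compact_continuous_image continuous_on_linear_combination compact_functions_into_compact) auto
  have "cball 0 r \<subseteq> T ` {c. \<forall>i. c i \<in> {-R..R}}"
  proof
    fix x :: 'a assume "x \<in> cball 0 r"
    then have x: "norm x \<le> \<bar>r\<bar>" by simp
    have "\<bar>representation B x i\<bar> \<le> R" for i
    proof (cases "i \<in> B")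
      case True
      then show ?thesis using m(2)[OF True, of x] x m(1) by (simp add: R_def field_simps)
    next
      case False
      then have "representation B x i = 0" using representation_ne_zero by blast
      then show ?thesis using m(1) by (simp add: R_def)
    qed
    then have "\<forall>i. representation B x i \<in> {-R..R}"
      by (metis abs_le_iff atLeastAtMost_iff minus_le_iff)
    moreover have "T (representation B x) = x"
      using sum_representation_eq[OF ind _ fin subset_refl, of x] span by (simp add: T_def)
    ultimately show "x \<in> T ` {c. \<forall>i. c i \<in> {-R..R}}"
      by (intro image_eqI[where x="representation B x"]) auto
  qed
  with comp show ?thesis
    by (metis closed_cball compact_Int_closed inf.absorb_iff2)
qed

lemma bounded_linear_finite_dim:
  fixes B :: "'a::real_normed_vector set" and f :: "'a \<Rightarrow> 'b::real_normed_vector"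
  assumes fin: "finite B" and ind: "independent B" and span: "span B = UNIV" and "linear f"
  shows "bounded_linear f"
proof -
  obtain m where m: "m > 0" "\<And>x b. b \<in> B \<Longrightarrow> m * \<bar>representation B x b\<bar> \<le> norm x"
    using coordinates_bounded[OF fin ind span] by blast
  interpret linear f by fact
  have "norm (f x) \<le> norm x * (\<Sum>b\<in>B. norm (f b) / m)" for x
  proof -
    have "f x = f (\<Sum>b\<in>B. representation B x b *\<^sub>R b)"
      using sum_representation_eq[OF ind _ fin subset_refl, of x] span by simp
    also have "\<dots> = (\<Sum>b\<in>B. representation B x b *\<^sub>R f b)"
      by (simp add: sum scale)
    also have "norm \<dots> \<le> (\<Sum>b\<in>B. norm x * (norm (f b) / m))"
    proof (rule sum_norm_le)
      fix b assume "b \<in> B"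
      have "\<bar>representation B x b\<bar> \<le> norm x / m"
        using m(2)[OF \<open>b \<in> B\<close>, of x] m(1) by (simp add: field_simps)
      then have "\<bar>representation B x b\<bar> * norm (f b) \<le> norm x / m * norm (f b)"
        by (rule mult_right_mono) simp
      then show "norm (representation B x b *\<^sub>R f b) \<le> norm x * (norm (f b) / m)"
        by simp
    qed
    finally show ?thesis by (simp add: sum_distrib_left)
  qed
  then show ?thesis
    by (intro bounded_linear_intro[where K="\<Sum>b\<in>B. norm (f b) / m"]) (auto simp: add scale)
qed

section \<open>Norming functionals\<close>

lemma functional_vanishing_on_subspace:
  fixes S :: "'a::real_vector set"
  assumes "subspace S" "a \<notin> S"
  obtains \<phi> :: "'a \<Rightarrow> real" where "linear \<phi>" "\<phi> a = 1" "\<And>x. x \<in> S \<Longrightarrow> \<phi> x = 0"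
proof -
  obtain C where C: "C \<subseteq> S" "independent C" "S \<subseteq> span C"
    by (rule basis_exists[of S])
  have "span C = S"
    using C assms(1) by (metis span_minimal subset_antisym)
  then have "independent (insert a C)" "a \<notin> C"
    using C assms by (auto simp: independent_insert)
  then obtain \<phi> :: "'a \<Rightarrow> real" where \<phi>: "linear \<phi>" "\<forall>x\<in>insert a C. \<phi> x = (if x = a then 1 else 0)"
      using linear_independent_extend[OF \<open>independent (insert a C)\<close>, of "\<lambda>x. if x = a then 1 else 0"] by blast
  have "\<phi> c = 0" if "c \<in> C" for c
    using \<phi>(2) \<open>a \<notin> C\<close> that by auto
  then have "\<phi> x = 0" if "x \<in> S" for x
    using linear_eq_0_on_span[OF \<phi>(1), of C x] that \<open>span C = S\<close> by blast
  then show ?thesis using that[of \<phi>] \<phi> by simp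
qed

text \<open>
  The extension step of Hahn and Banach. An extension of \<open>g\<close> is determined by its value \<open>t\<close> at \<open>a\<close>,
  and domination by the norm only asks \<open>t\<close> to lie above all numbers \<open>g y - norm (y - a)\<close> and below
  all numbers \<open>norm (z + a) - g z\<close>. The triangle inequality puts the first below the second.
\<close>

lemma dominated_functional_extend_one:
  fixes g :: "'a::real_normed_vector \<Rightarrow> real"
  assumes g: "linear g" and S: "subspace S" and dom: "\<And>x. x \<in> S \<Longrightarrow> g x \<le> norm x"
  obtains h :: "'a \<Rightarrow> real" where "linear h" "\<And>x. x \<in> S \<Longrightarrow> h x = g x"
    "\<And>x. x \<in> span (insert a S) \<Longrightarrow> h x \<le> norm x"
proof (cases "a \<in> S")
  case True
  then have "span (insert a S) = S" using S by (simp add: insert_absorb)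
  then show ?thesis using that[of g] assms by simp
next
  case False
  interpret g: linear g by fact
  obtain \<phi> :: "'a \<Rightarrow> real" where \<phi>: "linear \<phi>" "\<phi> a = 1" "\<And>x. x \<in> S \<Longrightarrow> \<phi> x = 0"
    using functional_vanishing_on_subspace[OF S False] by blast
  define t where "t = (SUP y\<in>S. g y - norm (y - a))"
  have sep: "g y - norm (y - a) \<le> norm (z + a) - g z" if "y \<in> S" "z \<in> S" for y z
  proof -
    have "g y + g z \<le> norm (y + z)"
      using dom[OF subspace_add[OF S that]] by (simp add: g.add)
    also have "\<dots> \<le> norm (y - a) + norm (z + a)"
      using norm_triangle_ineq[of "y - a" "z + a"] by simp
    finally show ?thesis by simp
  qed
  have "0 \<in> S" using S by (rule subspace_0)
  have lower: "g y - norm (y - a) \<le> t" if "y \<in> S" for y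
    unfolding t_def by (intro cSUP_upper that bdd_aboveI2[where M="norm (0 + a) - g 0"] sep \<open>0 \<in> S\<close>)
  have upper: "t \<le> norm (z + a) - g z" if "z \<in> S" for z
    unfolding t_def using \<open>0 \<in> S\<close> sep that by (intro cSUP_least) auto
  define h where "h x = g x + (t - g a) * \<phi> x" for x
  have "linear h"
    by (rule linearI)
      (simp_all add: h_def g.add g.scale linear_add[OF \<phi>(1)] linear_cmul[OF \<phi>(1)] algebra_simps)
  moreover have "h x = g x" if "x \<in> S" for x
    using \<phi>(3)[OF that] by (simp add: h_def)
  moreover have "h x \<le> norm x" if x_in: "x \<in> span (insert a S)" for x
  proof -
    have "span S = S" using S by simp
    then obtain k where k: "x - k *\<^sub>R a \<in> S"
      using x_in by (metis span_breakdown_eq)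
    define y where "y = x - k *\<^sub>R a"
    have x: "x = y + k *\<^sub>R a" and y: "y \<in> S" using k by (auto simp: y_def)
    interpret \<phi>: linear \<phi> by fact
    have hx: "h x = g y + k * t"
      using \<phi>(2) \<phi>(3)[OF y] by (simp add: h_def x g.add g.scale \<phi>.add \<phi>.scale algebra_simps)
    consider "k = 0" | "k > 0" | "k < 0" by linarith
    then show ?thesis
    proof cases
      case 1
      then show ?thesis using dom[OF y] hx x by simp
    next
      case 2
      have "(1/k) *\<^sub>R y \<in> S" using S y by (rule subspace_scale)
      then have "t \<le> norm ((1/k) *\<^sub>R y + a) - g y / k"
        using upper[of "(1/k) *\<^sub>R y"] by (simp add: g.scale)
      then have "k * t \<le> k * norm ((1/k) *\<^sub>R y + a) - g y"
        using 2 by (simp add: field_simps)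
      also have "k * norm ((1/k) *\<^sub>R y + a) = norm (k *\<^sub>R ((1/k) *\<^sub>R y + a))"
        using 2 by simp
      also have "k *\<^sub>R ((1/k) *\<^sub>R y + a) = x"
        using 2 by (simp add: x scaleR_add_right)
      finally show ?thesis using hx by simp
    next
      case 3
      have "(-1/k) *\<^sub>R y \<in> S" using S y by (rule subspace_scale)
      then have "- g y / k - norm ((-1/k) *\<^sub>R y - a) \<le> t"
        using lower[of "(-1/k) *\<^sub>R y"] by (simp add: g.scale g.neg)
      then have "k * t \<le> (-k) * norm ((-1/k) *\<^sub>R y - a) - g y"
        using 3 by (simp add: field_simps)
      also have "(-k) * norm ((-1/k) *\<^sub>R y - a) = norm ((-k) *\<^sub>R ((-1/k) *\<^sub>R y - a))"
        using 3 by simp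
      also have "(-k) *\<^sub>R ((-1/k) *\<^sub>R y - a) = x"
        using 3 by (simp add: x scaleR_diff_right)
      finally show ?thesis using hx by simp
    qed
  qed
  ultimately show ?thesis using that by blast
qed

text \<open>
  Start with the functional that is the norm on the ray through \<open>x\<close>, and extend it over one
  spanning vector at a time.
\<close>

lemma norming_functional_finite_dim:
  fixes B :: "'a::real_normed_vector set"
  assumes "finite B" and span: "span B = UNIV"
  obtains g :: "'a \<Rightarrow> real" where "linear g" "g x = norm x" "\<And>y. \<bar>g y\<bar> \<le> norm y"
proof -
  have "\<exists>g :: 'a \<Rightarrow> real. linear g \<and> g x = norm x \<and> (\<forall>y\<in>span (insert x A). g y \<le> norm y)"
    if "finite A" for A
    using that
  proof induction
    case empty
    show ?case
    proof (cases "x = 0")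
      case True
      then show ?thesis by (intro exI[of _ "\<lambda>_. 0"]) (auto intro: linear_zero)
    next
      case False
      then obtain \<phi> :: "'a \<Rightarrow> real" where \<phi>: "linear \<phi>" "\<phi> x = 1"
        using functional_vanishing_on_subspace[of "{0}" x] by auto
      have "norm x * \<phi> y \<le> norm y" if y: "y \<in> span {x}" for y
      proof -
        obtain c where "y = c *\<^sub>R x" using y by (auto simp: span_singleton)
        then show ?thesis
          using \<phi> mult_right_mono[OF abs_ge_self[of c] norm_ge_zero[of x]]
          by (simp add: linear_cmul mult.commute)
      qed
      moreover have "linear (\<lambda>y. norm x * \<phi> y)"
        using linear_compose_scale_right[OF \<phi>(1), of "norm x"] by simp
      ultimately show ?thesis using \<phi>(2) by (intro exI[of _ "\<lambda>y. norm x * \<phi> y"]) auto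
    qed
  next
    case (insert a A)
    then obtain g :: "'a \<Rightarrow> real" where g: "linear g" "g x = norm x"
      "\<And>y. y \<in> span (insert x A) \<Longrightarrow> g y \<le> norm y" by blast
    obtain h :: "'a \<Rightarrow> real" where h: "linear h" "\<And>y. y \<in> span (insert x A) \<Longrightarrow> h y = g y"
      "\<And>y. y \<in> span (insert a (span (insert x A))) \<Longrightarrow> h y \<le> norm y"
      using dominated_functional_extend_one[OF g(1) subspace_span g(3)] by blast
    have "span (insert x (insert a A)) \<subseteq> span (insert a (span (insert x A)))"
      by (intro span_mono) (auto intro: span_base)
    then have "\<forall>y\<in>span (insert x (insert a A)). h y \<le> norm y"
      using h(3) by blast
    moreover have "h x = norm x"
      using h(2)[of x] g(2) by (simp add: span_base)
    ultimately show ?case using h(1) by blast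
  qed
  from this[OF assms(1)] obtain g :: "'a \<Rightarrow> real" where g: "linear g" "g x = norm x"
    "\<And>y. y \<in> span (insert x B) \<Longrightarrow> g y \<le> norm y" by blast
  have "span (insert x B) = UNIV"
    using span span_mono[of B "insert x B"] by auto
  then have le: "g y \<le> norm y" for y using g(3) by auto
  have "\<bar>g y\<bar> \<le> norm y" for y
    using le[of y] le[of "-y"] linear_neg[OF g(1), of y] by (simp add: abs_le_iff)
  then show ?thesis using that g by blast
qed

section \<open>Helly's theorem in an affine hyperplane\<close>

text \<open>
  The hyperplane of height 1 has dimension \<open>n - 1\<close>, so the Helly number is \<open>n\<close>. For Radon's
  partition, a linear dependence between more than \<open>n\<close> points of height 1 is automatically an affine
  one: applying \<open>f\<close> to it shows that the coefficients sum to 0.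
\<close>

lemma helly_in_hyperplane:
  fixes B :: "'a::real_vector set" and f :: "'a \<Rightarrow> real" and C :: "'i \<Rightarrow> 'a set"
  assumes "finite B" and span: "span B = UNIV" and "card B = n" and f: "linear f"
    and "finite J" and conv: "\<And>j. j \<in> J \<Longrightarrow> convex (C j)"
    and meet: "\<And>T. T \<subseteq> J \<Longrightarrow> card T \<le> n \<Longrightarrow> \<exists>w. f w = 1 \<and> (\<forall>j\<in>T. w \<in> C j)"
  shows "\<exists>w. f w = 1 \<and> (\<forall>j\<in>J. w \<in> C j)"
  using assms(5-7)
proof (induction "card J" arbitrary: J rule: less_induct)
  case less
  interpret f: linear f by fact
  show ?case
  proof (cases "card J \<le> n")
    case True
    then show ?thesis using less.prems by blast
  next
    case False
    have "\<exists>w. f w = 1 \<and> (\<forall>i\<in>J - {j}. w \<in> C i)" if "j \<in> J" for j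
    proof (rule less.hyps)
      show "card (J - {j}) < card J"
        using \<open>finite J\<close> that by (rule card_Diff1_less)
      show "\<exists>w. f w = 1 \<and> (\<forall>i\<in>T. w \<in> C i)" if "T \<subseteq> J - {j}" "card T \<le> n" for T
        using that by (intro less.prems(3)) auto
    qed (use less.prems in auto)
    then obtain w where fw: "\<And>j. j \<in> J \<Longrightarrow> f (w j) = 1"
      and w: "\<And>j i. j \<in> J \<Longrightarrow> i \<in> J \<Longrightarrow> i \<noteq> j \<Longrightarrow> w j \<in> C i"
      by (metis Diff_iff singletonD)
    show ?thesis
    proof (cases "inj_on w J")
      case False
      then obtain j k where jk: "j \<in> J" "k \<in> J" "j \<noteq> k" "w j = w k"
        by (auto simp: inj_on_def)
      then have "w j \<in> C i" if "i \<in> J" for i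
        using w[of j i] w[of k i] that by (cases "i = j") auto
      then show ?thesis using fw jk(1) by blast
    next
      case True
      let ?W = "w ` J"
      have "finite ?W" "card ?W > n"
        using less.prems(1) False True by (simp_all add: card_image)
      then have "dependent ?W"
        using independent_span_bound[of B ?W] assms(1,3) span by force
      then obtain u where u: "\<exists>v\<in>?W. u v \<noteq> 0" "(\<Sum>v\<in>?W. u v *\<^sub>R v) = 0"
        using dependent_finite[OF \<open>finite ?W\<close>] by blast
      \<comment> \<open>The Radon point of the points \<open>w j\<close>, each of which misses at most \<open>C j\<close>, is
          in every \<open>C i\<close>: one of the two parts avoids \<open>w i\<close> and so lies in
          \<open>C i\<close>.\<close>
      have "(\<Sum>v\<in>?W. u v) = (\<Sum>v\<in>?W. u v * f v)"
        using fw by (intro sum.cong) auto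
      also have "\<dots> = f (\<Sum>v\<in>?W. u v *\<^sub>R v)"
        by (simp add: f.sum f.scale)
      finally have "affine_dependent ?W"
        unfolding affine_dependent_explicit_finite[OF \<open>finite ?W\<close>] using u f.zero by auto
      then obtain M P where MP: "M \<inter> P = {}" "M \<union> P = ?W"
        and "(convex hull M) \<inter> (convex hull P) \<noteq> {}"
        using Radon_partition[OF \<open>finite ?W\<close>] by blast
      then obtain z where z: "z \<in> convex hull M" "z \<in> convex hull P" by blast
      have "convex {w. f w = 1}"
        by (rule convexI) (simp add: f.add f.scale)
      moreover have "?W \<subseteq> {w. f w = 1}" using fw by (simp add: image_subset_iff)
      then have "M \<subseteq> {w. f w = 1}" using MP(2) by (metis Un_subset_iff)
      ultimately have "f z = 1" using z(1) hull_minimal[of M _ convex] by blast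
      moreover have "z \<in> C i" if i: "i \<in> J" for i
      proof -
        have off: "z \<in> C i" if "w i \<notin> Q" "Q \<subseteq> ?W" "z \<in> convex hull Q" for Q
        proof -
          have "Q \<subseteq> C i" using that(1,2) w i by blast
          then show ?thesis
            using less.prems(2)[OF i] that(3) hull_minimal[of Q _ convex] by blast
        qed
        have "w i \<notin> M \<or> w i \<notin> P" using MP(1) by blast
        then show ?thesis using off[of M] off[of P] MP(2) z by blast
      qed
      ultimately show ?thesis by blast
    qed
  qed
qed

section \<open>A tuple that no projection moves little\<close>

text \<open>
  If a value below \<open>L\<close> is attained for each parameter \<open>x\<close> separately, a bound below \<open>L\<close> holds
  uniformly: the open sets of parameters for which a given \<open>w\<close> achieves a given \<open>c < L\<close> cover \<open>K\<close>,
  and a finite subcover has a largest \<open>c\<close>.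
\<close>

lemma uniform_bound_on_compact:
  fixes K :: "'b::topological_space set" and \<psi> :: "'w \<Rightarrow> 'i \<Rightarrow> 'b \<Rightarrow> real"
  assumes "compact K" "finite I" and cont: "\<And>w i. continuous_on UNIV (\<psi> w i)"
    and "\<And>x. x \<in> K \<Longrightarrow> \<exists>w\<in>H. \<forall>i\<in>I. \<psi> w i x < L"
  shows "\<exists>c<L. \<forall>x\<in>K. \<exists>w\<in>H. \<forall>i\<in>I. \<psi> w i x \<le> c"
proof -
  define U where "U = (\<lambda>(w, c). \<Inter>i\<in>I. {x. \<psi> w i x < c})"
  have opn: "open (U p)" for p
    unfolding U_def case_prod_beta
    by (intro open_INT ballI open_Collect_less cont continuous_on_const \<open>finite I\<close>)
  have "K \<subseteq> (\<Union>p\<in>H \<times> {..<L}. U p)"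
  proof
    fix x assume "x \<in> K"
    then obtain w where w: "w \<in> H" "\<forall>i\<in>I. \<psi> w i x < L" using assms(4) by blast
    define m where "m = Max (insert (L - 1) ((\<lambda>i. \<psi> w i x) ` I))"
    have "m < L" unfolding m_def using w(2) \<open>finite I\<close> by auto
    moreover have "\<psi> w i x \<le> m" if "i \<in> I" for i
      unfolding m_def using that \<open>finite I\<close> by (intro Max_ge) auto
    ultimately have "x \<in> U (w, (m + L) / 2)" "(m + L) / 2 < L"
      by (force simp: U_def)+
    then show "x \<in> (\<Union>p\<in>H \<times> {..<L}. U p)" using w(1) by blast
  qed
  then obtain D where D: "D \<subseteq> H \<times> {..<L}" "finite D" "K \<subseteq> (\<Union>p\<in>D. U p)"
    using compactE_image[OF \<open>compact K\<close>, of "H \<times> {..<L}" U] opn by metis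
  define c where "c = Max (insert (L - 1) (snd ` D))"
  have "c < L" unfolding c_def using D(1,2) by auto
  moreover have "\<exists>w\<in>H. \<forall>i\<in>I. \<psi> w i x \<le> c" if x: "x \<in> K" for x
  proof -
    obtain w d where wd: "(w, d) \<in> D" "x \<in> U (w, d)" using D(3) x by (metis UN_E subsetD surj_pair)
    then have "d \<le> c"
      unfolding c_def using D(2) by (intro Max_ge) force+
    then have "\<forall>i\<in>I. \<psi> w i x \<le> c" using wd(2) by (force simp: U_def)
    then show ?thesis using wd(1) D(1) by blast
  qed
  ultimately show ?thesis by blast
qed

text \<open>
  Every projection onto the kernel of \<open>f\<close> is of the form \<open>x \<mapsto> x - f x *\<^sub>R w\<close> with \<open>f w = 1\<close>. That these maps
  are projections bounds the projection constant from above.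
\<close>

lemma rel_proj_const_hyperplane_le:
  fixes f :: "'a::real_normed_vector \<Rightarrow> real"
  assumes f: "bounded_linear f" and "f w = 1" and "c \<ge> 0"
    and le: "\<And>x. norm x \<le> 1 \<Longrightarrow> norm (x - f x *\<^sub>R w) \<le> c"
  shows "rel_proj_const {x. f x = 0} \<le> c"
proof -
  interpret f: bounded_linear f by fact
  let ?P = "\<lambda>x. x - f x *\<^sub>R w"
  have "bounded_linear ?P"
    by (intro bounded_linear_sub bounded_linear_ident bounded_linear_scaleR_const f)
  then have proj: "is_projection_onto ?P {x. f x = 0}"
    using \<open>f w = 1\<close> by (auto simp: is_projection_onto_def f.diff f.scaleR)
  have "norm (?P x) \<le> c * norm x" for x
  proof (cases "x = 0")
    case False
    have "?P ((1 / norm x) *\<^sub>R x) = (1 / norm x) *\<^sub>R ?P x"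
      by (simp add: f.scaleR scaleR_diff_right)
    then have "norm (?P x) / norm x \<le> c"
      using le[of "(1 / norm x) *\<^sub>R x"] False by simp
    then show ?thesis using False by (simp add: field_simps)
  qed (simp add: f.zero)
  then have "onorm ?P \<le> c"
    using \<open>c \<ge> 0\<close> by (intro onorm_bound) auto
  moreover have "rel_proj_const {x. f x = 0} \<le> onorm ?P"
    unfolding rel_proj_const_def
    by (rule cINF_lower) (use proj onorm_pos_le in \<open>auto intro!: bdd_belowI2[where m=0] simp: is_projection_onto_def\<close>)
  ultimately show ?thesis by simp
qed

text \<open>
  For fixed \<open>x\<close>, the vectors \<open>w\<close> of height 1 with \<open>norm (x - f x *\<^sub>R w) \<le> c\<close> form a closed convex set.
  By assumption any \<open>n\<close> of these sets meet, so by Helly finitely many always meet, and by compactness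
  all of them do. The vector \<open>a\<close> of nonzero height is what makes one of the sets bounded.
\<close>

lemma common_displacement_bound:
  fixes B :: "'a::real_normed_vector set" and f :: "'a \<Rightarrow> real"
  assumes fin: "finite B" and ind: "independent B" and span: "span B = UNIV" and "card B = n"
    and f: "bounded_linear f" and a: "norm a \<le> 1" "f a \<noteq> 0"
    and tuples: "\<And>x :: nat \<Rightarrow> 'a. (\<And>i. norm (x i) \<le> 1) \<Longrightarrow>
      \<exists>w. f w = 1 \<and> (\<forall>i<n. norm (x i - f (x i) *\<^sub>R w) \<le> c)"
  obtains w where "f w = 1" "\<And>x. norm x \<le> 1 \<Longrightarrow> norm (x - f x *\<^sub>R w) \<le> c"
proof -
  interpret f: bounded_linear f by fact
  define C where "C x = {w. norm (x - f x *\<^sub>R w) \<le> c}" for x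
  have conv: "convex (C x)" for x
  proof -
    show ?thesis
    proof (rule convexI)
      fix u v :: 'a and s t :: real
      assume uv: "u \<in> C x" "v \<in> C x" and st: "0 \<le> s" "0 \<le> t" "s + t = 1"
      have "x - f x *\<^sub>R (s *\<^sub>R u + t *\<^sub>R v) = s *\<^sub>R (x - f x *\<^sub>R u) + t *\<^sub>R (x - f x *\<^sub>R v)"
        using st(3) by (simp add: algebra_simps flip: scaleR_add_left)
      also have "norm \<dots> \<le> s * norm (x - f x *\<^sub>R u) + t * norm (x - f x *\<^sub>R v)"
        using st by (metis abs_of_nonneg norm_scaleR norm_triangle_ineq)
      also have "\<dots> \<le> c"
        using uv st by (intro convex_bound_le) (auto simp: C_def)
      finally show "s *\<^sub>R u + t *\<^sub>R v \<in> C x" by (simp add: C_def)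
    qed
  qed
  have finite_meet: "\<exists>w. f w = 1 \<and> (\<forall>x\<in>J. w \<in> C x)" if J: "finite J" "J \<subseteq> cball 0 1" for J
  proof (rule helly_in_hyperplane[OF fin span \<open>card B = n\<close> f.linear J(1) conv])
    fix T assume T: "T \<subseteq> J" "card T \<le> n"
    then have "finite T" using J(1) finite_subset by blast
    then obtain h where h: "bij_betw h {0..<card T} T"
      using ex_bij_betw_nat_finite by blast
    \<comment> \<open>When \<open>T\<close> has fewer than \<open>n\<close> elements, 0 fills the remaining places of the
        tuple.\<close>
    define x where "x i = (if i < card T then h i else 0)" for i
    have "x i \<in> insert 0 T" for i
      using h by (auto simp: x_def bij_betw_def)
    then have "norm (x i) \<le> 1" for i
      using T(1) J(2) by (metis insert_iff mem_cball_0 norm_zero subsetD zero_le_one)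
    then obtain w where w: "f w = 1" "\<forall>i<n. norm (x i - f (x i) *\<^sub>R w) \<le> c"
      using tuples by blast
    have "w \<in> C y" if y: "y \<in> T" for y
    proof -
      obtain i where i: "i < card T" "h i = y"
        using h y by (metis atLeastLessThan_iff bij_betw_imp_surj_on imageE)
      then have "x i = y" "i < n" using T(2) by (auto simp: x_def)
      then show ?thesis using w(2) by (auto simp: C_def)
    qed
    then show "\<exists>w. f w = 1 \<and> (\<forall>j\<in>T. w \<in> C j)" using w(1) by blast
  qed
  have clC: "closed (C x)" for x
    unfolding C_def by (intro closed_Collect_le continuous_intros)
  have clH: "closed {w. f w = 1}"
    by (intro closed_Collect_eq continuous_intros f.continuous_on)
  have "C a \<subseteq> cball 0 ((c + 1) / \<bar>f a\<bar>)"
  proof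
    fix w assume "w \<in> C a"
    then have "norm (f a *\<^sub>R w) \<le> c + 1"
      using norm_triangle_ineq2[of "f a *\<^sub>R w" a] a(1) by (simp add: C_def norm_minus_commute)
    then show "w \<in> cball 0 ((c + 1) / \<bar>f a\<bar>)"
      using a(2) by (simp add: field_simps)
  qed
  then have "C a \<inter> {w. f w = 1} = cball 0 ((c + 1) / \<bar>f a\<bar>) \<inter> (C a \<inter> {w. f w = 1})" by blast
  then have "compact (C a \<inter> {w. f w = 1})"
    using compact_Int_closed[OF compact_cball_finite_dim[OF fin ind span] closed_Int[OF clC clH]] by metis
  then have "C a \<inter> {w. f w = 1} \<inter> (\<Inter>x\<in>cball 0 1. C x) \<noteq> {}"
  proof (rule compact_imp_fip_image)
    fix J assume "finite J" "J \<subseteq> cball (0::'a) 1"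
    then show "C a \<inter> {w. f w = 1} \<inter> (\<Inter>x\<in>J. C x) \<noteq> {}"
      using finite_meet[of "insert a J"] a(1) by auto
  qed (rule clC)
  then obtain w where "f w = 1" "\<forall>x\<in>cball 0 1. w \<in> C x" by blast
  then show ?thesis using that[of w] by (simp add: C_def)
qed

text \<open>
  The norm of a projection is a supremum over the unit ball, but \<open>n\<close> suitable points of the ball
  already witness that no projection has norm below the projection constant. If every \<open>n\<close>-tuple
  had a better \<open>w\<close>, then by compactness of the set of tuples one \<open>c\<close> below the constant would serve
  all tuples, and by Helly a single \<open>w\<close> would serve all points. Replacing points by their negatives
  makes all heights nonnegative.
\<close>

lemma extremal_tuple:
  fixes B :: "'a::real_normed_vector set" and f :: "'a \<Rightarrow> real"
  assumes fin: "finite B" and ind: "independent B" and span: "span B = UNIV" and "card B = n"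
    and f: "bounded_linear f" and nz: "f v \<noteq> 0"
  obtains x :: "nat \<Rightarrow> 'a" where "\<And>i. norm (x i) \<le> 1" "\<And>i. f (x i) \<ge> 0"
    "\<And>w. f w = 1 \<Longrightarrow> \<exists>i<n. norm (x i - f (x i) *\<^sub>R w) \<ge> rel_proj_const {x. f x = 0}"
proof -
  interpret f: bounded_linear f by fact
  let ?L = "rel_proj_const {x. f x = 0}"
  have "v \<noteq> 0" using nz f.zero by auto
  define a where "a = (1 / norm v) *\<^sub>R v"
  have a: "norm a \<le> 1" "f a \<noteq> 0"
    using nz \<open>v \<noteq> 0\<close> by (simp_all add: a_def f.scaleR)
  have "\<exists>x :: nat \<Rightarrow> 'a. (\<forall>i. norm (x i) \<le> 1) \<and>
      (\<forall>w. f w = 1 \<longrightarrow> (\<exists>i<n. norm (x i - f (x i) *\<^sub>R w) \<ge> ?L))"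
  proof (rule ccontr)
    assume no_tuple: "\<not> ?thesis"
    have good: "\<exists>w\<in>{w. f w = 1}. \<forall>i\<in>{..<n}. norm (x i - f (x i) *\<^sub>R w) < ?L"
      if "x \<in> {x. \<forall>i. x i \<in> cball 0 1}" for x :: "nat \<Rightarrow> 'a"
    proof -
      have "\<forall>i. norm (x i) \<le> 1" using that by simp
      then have "\<not> (\<forall>w. f w = 1 \<longrightarrow> (\<exists>i<n. norm (x i - f (x i) *\<^sub>R w) \<ge> ?L))"
        using no_tuple by blast
      then show ?thesis by (auto simp: not_le)
    qed
    have compact: "compact {x :: nat \<Rightarrow> 'a. \<forall>i. x i \<in> cball 0 1}"
      by (intro compact_functions_into_compact compact_cball_finite_dim[OF fin ind span])
    have cont: "continuous_on UNIV (\<lambda>x :: nat \<Rightarrow> 'a. norm (x i - f (x i) *\<^sub>R w))" for w i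
      by (intro continuous_intros f.continuous_on continuous_on_product_coordinates)
    have "\<exists>c<?L. \<forall>x\<in>{x :: nat \<Rightarrow> 'a. \<forall>i. x i \<in> cball 0 1}.
        \<exists>w\<in>{w. f w = 1}. \<forall>i\<in>{..<n}. norm (x i - f (x i) *\<^sub>R w) \<le> c"
      by (rule uniform_bound_on_compact[OF compact finite_lessThan cont good])
    then obtain c where c: "c < ?L" "\<forall>x\<in>{x :: nat \<Rightarrow> 'a. \<forall>i. x i \<in> cball 0 1}.
        \<exists>w\<in>{w. f w = 1}. \<forall>i\<in>{..<n}. norm (x i - f (x i) *\<^sub>R w) \<le> c"
      by (elim exE conjE) (rule that)
    have "\<exists>w. f w = 1 \<and> (\<forall>i<n. norm (x i - f (x i) *\<^sub>R w) \<le> c)"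
      if "\<And>i. norm (x i) \<le> 1" for x :: "nat \<Rightarrow> 'a"
    proof -
      have "x \<in> {x. \<forall>i. x i \<in> cball 0 1}" using that by simp
      from bspec[OF c(2) this] show ?thesis by (simp add: Ball_def)
    qed
    then obtain w where w: "f w = 1" "\<And>x. norm x \<le> 1 \<Longrightarrow> norm (x - f x *\<^sub>R w) \<le> c"
      using common_displacement_bound[OF fin ind span \<open>card B = n\<close> f a, of c] by blast
    have "c \<ge> 0" using w(2)[of 0] by (simp add: f.zero)
    then have "?L \<le> c" using rel_proj_const_hyperplane_le[OF f w(1) _ w(2)] by blast
    with c(1) show False by simp
  qed
  then obtain x :: "nat \<Rightarrow> 'a" where x: "\<And>i. norm (x i) \<le> 1"
    "\<And>w. f w = 1 \<Longrightarrow> \<exists>i<n. norm (x i - f (x i) *\<^sub>R w) \<ge> ?L" by blast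
  define y where "y i = (if f (x i) \<ge> 0 then x i else - x i)" for i
  have "norm (y i - f (y i) *\<^sub>R w) = norm (x i - f (x i) *\<^sub>R w)" for i w
    using norm_minus_cancel[of "x i - f (x i) *\<^sub>R w"] by (simp add: y_def f.neg)
  then show ?thesis
    using that[of y] x by (auto simp: y_def f.neg)
qed

section \<open>Weights that balance the heights\<close>

text \<open>
  The sum decreases continuously in \<open>\<kappa>\<close>, from half the number of positive \<open>f i\<close> at 0 down to 0, and so
  takes the value 1. A vanishing \<open>f i\<close> contributes 0, by the convention for division by 0.
\<close>

lemma balancing_threshold:
  fixes f :: "'i \<Rightarrow> real"
  assumes "finite I" and nonneg: "\<And>i. i \<in> I \<Longrightarrow> f i \<ge> 0" and "card {i\<in>I. f i > 0} \<ge> 2"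
  obtains \<kappa> where "\<kappa> \<ge> 0" "(\<Sum>i\<in>I. max 0 ((f i - \<kappa>) / (2 * f i))) = 1"
proof -
  define h where "h \<kappa> = (\<Sum>i\<in>I. max 0 ((f i - \<kappa>) / (2 * f i)))" for \<kappa>
  define M where "M = (\<Sum>i\<in>I. f i)"
  have "M \<ge> 0" unfolding M_def using nonneg by (rule sum_nonneg)
  have "f i \<le> M" if "i \<in> I" for i
    unfolding M_def using that nonneg \<open>finite I\<close> by (intro member_le_sum) auto
  then have "h M = 0"
    unfolding h_def using nonneg
    by (intro sum.neutral ballI max_absorb1 divide_nonpos_nonneg) auto
  have "h 0 = (\<Sum>i\<in>I. if f i > 0 then 1/2 else 0)"
    unfolding h_def using nonneg by (intro sum.cong) (auto simp: order_le_less)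
  also have "\<dots> = card {i\<in>I. f i > 0} / 2"
    using \<open>finite I\<close> by (simp add: sum.If_cases Int_def)
  finally have "h 0 \<ge> 1" using assms(3) by simp
  have "continuous_on {0..M} h"
    unfolding h_def divide_inverse by (intro continuous_intros)
  then obtain \<kappa> where "0 \<le> \<kappa>" "h \<kappa> = 1"
    using IVT2'[of h M 1 0] \<open>h M = 0\<close> \<open>h 0 \<ge> 1\<close> \<open>M \<ge> 0\<close> by auto
  then show ?thesis using that h_def by simp
qed

text \<open>
  In the application, \<open>f i\<close> is the height of the \<open>i\<close>-th extremal point \<open>x i\<close>, and the weights \<open>p\<close> stand
  for the projection along \<open>w = (\<Sum>j\<in>I. p j *\<^sub>R x j)\<close>, which moves \<open>x i\<close> to a point of norm at most
  \<open>1 + f i * ((\<Sum>j\<in>I. p j) - 2 * p i)\<close>. The lemma says that unless all heights agree, weights exist for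
  which this is below \<open>2 - 2 / n\<close> for every \<open>i\<close>.

  The good weights are proportional to \<open>q i = max 0 ((1 - \<kappa> / f i) / 2)\<close>, with \<open>\<kappa>\<close> such that they sum to 1.
  Then \<open>f i * (1 - 2 * q i) \<le> \<kappa>\<close> for all \<open>i\<close>, so everything depends on the ratio of \<open>\<kappa>\<close> to
  \<open>D = (\<Sum>i\<in>I. q i * f i)\<close>. On the set \<open>A\<close> of the \<open>m\<close> indices with \<open>q i > 0\<close>, both the sum of the
  \<open>1 / f i\<close> and the sum of the \<open>f i\<close> are known in terms of \<open>\<kappa>\<close> and \<open>D\<close>. The inequality between
  arithmetic and harmonic mean, used as nonnegativity of a sum of \<open>(f i - t)\<^sup>2 / f i\<close>, gives
  \<open>\<kappa> / D \<le> 1 - 2 / n\<close>, with equality only if \<open>m = n\<close> and all \<open>f i\<close> equal \<open>t\<close>.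
\<close>

lemma equal_heights_of_unbalanced:
  fixes f :: "'i \<Rightarrow> real" and n :: nat
  assumes "finite I" and card: "card I = n" and "n \<ge> 3"
    and nonneg: "\<And>i. i \<in> I \<Longrightarrow> f i \<ge> 0" and ex_pos: "\<exists>i\<in>I. f i > 0"
    and unbalanced: "\<And>p. (\<And>i. i \<in> I \<Longrightarrow> p i \<ge> 0) \<Longrightarrow> (\<Sum>i\<in>I. p i * f i) = 1 \<Longrightarrow>
      \<exists>i\<in>I. f i * ((\<Sum>j\<in>I. p j) - 2 * p i) \<ge> 1 - 2 / real n"
  shows "\<exists>s>0. \<forall>i\<in>I. f i = s"
proof (cases "card {i\<in>I. f i > 0} \<ge> 2")
  case False
  \<comment> \<open>With only one positive height, all the weight goes to that index.\<close>
  obtain a where a: "a \<in> I" "f a > 0" using ex_pos by blast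
  have "{i\<in>I. f i > 0} = {a}"
  proof (rule ccontr)
    assume "{i\<in>I. f i > 0} \<noteq> {a}"
    then obtain b where "b \<in> I" "f b > 0" "b \<noteq> a" using a by blast
    then have "card {a, b} \<le> card {i\<in>I. f i > 0}"
      using a \<open>finite I\<close> by (intro card_mono) auto
    then show False using False \<open>b \<noteq> a\<close> by simp
  qed
  then have zero: "f i = 0" if "i \<in> I" "i \<noteq> a" for i
    using that nonneg[of i] by (auto simp: order_le_less)
  define p where "p i = (if i = a then 1 / f a else 0)" for i
  have pn: "p i \<ge> 0" for i using a(2) by (simp add: p_def)
  have "(\<Sum>i\<in>I. p i * f i) = 1"
    using a \<open>finite I\<close> by (simp add: p_def if_distrib[of "\<lambda>x. x * _"] cong: if_cong)
  moreover have "(\<Sum>j\<in>I. p j) = 1 / f a"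
    using a \<open>finite I\<close> by (simp add: p_def)
  ultimately obtain i where i: "i \<in> I" "f i * (1 / f a - 2 * p i) \<ge> 1 - 2 / real n"
    using unbalanced[of p] pn by auto
  have "f i * (1 / f a - 2 * p i) \<le> 0"
    using zero[OF i(1)] a by (cases "i = a") (auto simp: p_def field_simps)
  moreover have "1 - 2 / real n > 0" using \<open>n \<ge> 3\<close> by simp
  ultimately show ?thesis using i(2) by linarith
next
  case True
  obtain \<kappa> where \<kappa>: "\<kappa> \<ge> 0" "(\<Sum>i\<in>I. max 0 ((f i - \<kappa>) / (2 * f i))) = 1"
    using balancing_threshold[OF \<open>finite I\<close> nonneg True] by blast
  define q where "q i = max 0 ((f i - \<kappa>) / (2 * f i))" for i
  define A where "A = {i\<in>I. f i > \<kappa>}"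
  define D where "D = (\<Sum>i\<in>I. q i * f i)"
  have "finite A" "A \<subseteq> I" using \<open>finite I\<close> by (auto simp: A_def)
  have fA: "f i > 0" "q i = (f i - \<kappa>) / (2 * f i)" if "i \<in> A" for i
    using that \<kappa>(1) by (auto simp: A_def q_def)
  have qoff: "q i = 0" if "i \<in> I - A" for i
    unfolding q_def using that nonneg[of i]
    by (intro max_absorb1 divide_nonpos_nonneg) (auto simp: A_def)
  have q_nonneg: "q i \<ge> 0" for i by (simp add: q_def)
  have sumq: "(\<Sum>i\<in>I. q i) = 1" using \<kappa>(2) by (simp add: q_def)
  have "(\<Sum>i\<in>A. q i) = 1"
    using sumq sum.mono_neutral_left[OF \<open>finite I\<close> \<open>A \<subseteq> I\<close>, of q] qoff by simp
  moreover have "(\<Sum>i\<in>A. q i) = (\<Sum>i\<in>A. 1/2 - (\<kappa>/2) * (1 / f i))"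
  proof (intro sum.cong refl)
    fix i assume "i \<in> A"
    from fA[OF this] show "q i = 1/2 - (\<kappa>/2) * (1 / f i)" by (simp add: field_simps)
  qed
  moreover have "(\<Sum>i\<in>A. 1/2 - (\<kappa>/2) * (1 / f i)) = card A / 2 - (\<kappa>/2) * (\<Sum>i\<in>A. 1 / f i)"
    unfolding sum_subtractf sum_distrib_left[symmetric] by simp
  ultimately have recip: "\<kappa> * (\<Sum>i\<in>A. 1 / f i) = real (card A) - 2"
    by linarith
  have "D = (\<Sum>i\<in>A. q i * f i)"
    unfolding D_def using qoff by (intro sum.mono_neutral_right \<open>finite I\<close> \<open>A \<subseteq> I\<close>) auto
  also have "\<dots> = (\<Sum>i\<in>A. (f i - \<kappa>) / 2)"
  proof (intro sum.cong refl)
    fix i assume "i \<in> A"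
    from fA[OF this] show "q i * f i = (f i - \<kappa>) / 2" by simp
  qed
  finally have D_eq: "D = (\<Sum>i\<in>A. (f i - \<kappa>) / 2)" .
  then have D: "2 * D = (\<Sum>i\<in>A. f i) - \<kappa> * card A"
    by (simp add: sum_divide_distrib[symmetric] sum_subtractf mult.commute)
  have "A \<noteq> {}" using \<open>(\<Sum>i\<in>A. q i) = 1\<close> by auto
  have "D > 0"
    unfolding D_eq
    by (intro sum_pos \<open>finite A\<close> \<open>A \<noteq> {}\<close>) (auto simp: A_def)
  have slope: "f i * (1 - 2 * q i) \<le> \<kappa>" if "i \<in> I" for i
    using that fA[of i] qoff[of i] by (cases "i \<in> A") (auto simp: A_def field_simps)
  obtain i where i: "i \<in> I" "f i * ((\<Sum>j\<in>I. q j / D) - 2 * (q i / D)) \<ge> 1 - 2 / real n"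
    using unbalanced[of "\<lambda>i. q i / D"] q_nonneg \<open>D > 0\<close>
    by (auto simp: D_def sum_divide_distrib[symmetric])
  have "f i * ((\<Sum>j\<in>I. q j / D) - 2 * (q i / D)) = f i * (1 - 2 * q i) / D"
    using \<open>D > 0\<close> sumq by (simp add: sum_divide_distrib[symmetric] field_simps)
  also have "\<dots> \<le> \<kappa> / D"
    using slope[OF i(1)] \<open>D > 0\<close> by (simp add: divide_right_mono)
  finally have "1 - 2 / real n \<le> \<kappa> / D" using i(2) by linarith
  then have tight: "(real n - 2) * D \<le> real n * \<kappa>"
    using \<open>D > 0\<close> \<open>n \<ge> 3\<close> by (simp add: field_simps)
  moreover have "(real n - 2) * D > 0"
    using \<open>D > 0\<close> \<open>n \<ge> 3\<close> by simp
  ultimately have "\<kappa> > 0"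
    using \<kappa>(1) by (cases "\<kappa> = 0") auto
  \<comment> \<open>The common height in the extremal case, where the \<open>n\<close> weights
      \<open>(1 - \<kappa> / t) / 2\<close> must sum to 1.\<close>
  define t where "t = real n * \<kappa> / (real n - 2)"
  have n2: "real n - 2 > 0" using \<open>n \<ge> 3\<close> by simp
  have tk: "(real n - 2) * t = real n * \<kappa>" using n2 by (simp add: t_def)
  have "t > 0" using n2 \<open>\<kappa> > 0\<close> \<open>n \<ge> 3\<close> by (simp add: t_def)
  have "card A \<le> n" using card \<open>finite I\<close> \<open>A \<subseteq> I\<close> card_mono by blast
  have "(\<Sum>i\<in>A. (f i - t)^2 / f i) = (\<Sum>i\<in>A. f i - 2 * t + t^2 * (1 / f i))"
  proof (intro sum.cong refl)
    fix i assume "i \<in> A"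
    from fA(1)[OF this] show "(f i - t)^2 / f i = f i - 2 * t + t^2 * (1 / f i)"
      by (simp add: field_simps power2_eq_square)
  qed
  also have "\<dots> = (\<Sum>i\<in>A. f i) - 2 * t * card A + t^2 * (\<Sum>i\<in>A. 1 / f i)"
    by (simp add: sum.distrib sum_subtractf sum_distrib_left)
  finally have var: "(\<Sum>i\<in>A. (f i - t)^2 / f i) = (\<Sum>i\<in>A. f i) - 2 * t * card A + t^2 * (\<Sum>i\<in>A. 1 / f i)" .
  define m where "m = real (card A)"
  define R where "R = (\<Sum>i\<in>A. 1 / f i)"
  define V where "V = (\<Sum>i\<in>A. (f i - t)^2 / f i)"
  define F where "F = (\<Sum>i\<in>A. f i)"
  note abb = m_def R_def V_def F_def
  have V_eq: "V = F - 2 * t * m + t^2 * R" using var abb by simp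
  have V_le: "(real n - 2)^2 * V \<le> 4 * \<kappa> * (m - real n)"
  proof -
    have "(real n - 2)^2 * V = (real n - 2)^2 * F - 2 * (real n - 2) * m * ((real n - 2) * t)
        + ((real n - 2) * t)^2 * R"
      unfolding V_eq by (simp add: algebra_simps power2_eq_square)
    also have "((real n - 2) * t)^2 * R = real n ^2 * \<kappa> * (\<kappa> * R)"
      unfolding tk by (simp add: power2_eq_square)
    also have "\<kappa> * R = m - 2" using recip abb by simp
    finally have 1: "(real n - 2)^2 * V = (real n - 2)^2 * F - 2 * (real n - 2) * m * (real n * \<kappa>)
        + real n ^2 * \<kappa> * (m - 2)" unfolding tk .
    have "(real n - 2) * (F - \<kappa> * m) \<le> 2 * real n * \<kappa>"
    proof -
      have "F - \<kappa> * m = 2 * D" using D abb by simp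
      then show ?thesis using tight by (simp add: algebra_simps)
    qed
    then have "(real n - 2) * ((real n - 2) * (F - \<kappa> * m)) \<le> (real n - 2) * (2 * real n * \<kappa>)"
      using n2 by simp
    then have "(real n - 2)^2 * F \<le> (real n - 2) * (2 * real n * \<kappa>) + (real n - 2)^2 * (\<kappa> * m)"
      by (simp add: algebra_simps power2_eq_square)
    then show ?thesis unfolding 1 by (simp add: algebra_simps power2_eq_square)
  qed
  have "V \<ge> 0"
    unfolding V_def by (intro sum_nonneg divide_nonneg_pos fA(1)) auto
  then have "0 \<le> 4 * \<kappa> * (m - real n)"
    using V_le by (intro order_trans[OF _ V_le]) simp
  then have "m = real n"
    using \<open>\<kappa> > 0\<close> \<open>card A \<le> n\<close> abb by (simp add: zero_le_mult_iff)
  then have "A = I"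
    using abb card \<open>A \<subseteq> I\<close> \<open>finite I\<close> by (simp add: card_subset_eq)
  have "(real n - 2)^2 * V \<le> 0"
    using V_le \<open>m = real n\<close> by simp
  then have "V = 0" using \<open>V \<ge> 0\<close> n2 by (simp add: mult_le_0_iff)
  then have "\<forall>i\<in>A. (f i - t)^2 / f i = 0"
    unfolding V_def
    by (subst (asm) sum_nonneg_eq_0_iff) (auto intro!: divide_nonneg_pos fA(1) \<open>finite A\<close>)
  then have "f i = t" if "i \<in> I" for i
    using that fA(1)[of i] \<open>A = I\<close> by auto
  then show ?thesis using \<open>t > 0\<close> by blast
qed

section \<open>The extremal points span a one-complemented plane\<close>

text \<open>
  Once the heights agree, extremality says that no convex combination of the points is closer than
  \<open>2 - 2 / n\<close> to all of them, although the triangle inequality gives \<open>2 * (1 - \<mu> i)\<close> as upper bound for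
  the distance from \<open>x i\<close>. If two of the points had distance less than 2, the barycentre would be too
  close to these two, and moving a little weight from them to the others would bring it too close
  to all. So all mutual distances are 2. Moreover the barycentre has distance \<open>2 - 2 / n\<close> from some
  \<open>x i\<close>, which leaves no room for cancellation between the remaining points: in particular
  \<open>norm (x j + x k) = 2\<close> for \<open>j\<close>, \<open>k\<close> different from \<open>i\<close>, and \<open>n \<ge> 3\<close> provides such \<open>j\<close> and \<open>k\<close>.
\<close>

lemma long_sum_and_difference:
  fixes x :: "nat \<Rightarrow> 'a::real_normed_vector"
  assumes n: "n \<ge> 3" and unit: "\<And>i. i < n \<Longrightarrow> norm (x i) \<le> 1"
    and far: "\<And>\<mu>. (\<And>i. i < n \<Longrightarrow> \<mu> i \<ge> 0) \<Longrightarrow> (\<Sum>i<n. \<mu> i) = 1 \<Longrightarrow>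
      \<exists>i<n. norm (x i - (\<Sum>j<n. \<mu> j *\<^sub>R x j)) \<ge> 2 - 2 / real n"
  obtains j k where "j < n" "k < n" "norm (x j - x k) \<ge> 2" "norm (x j + x k) \<ge> 2"
proof -
  have n0: "real n > 0" "real n \<ge> 3" using n by auto
  have dist_le: "norm (x i - (\<Sum>j<n. \<mu> j *\<^sub>R x j)) \<le> (\<Sum>j<n. \<mu> j * norm (x i - x j))"
    if "\<And>j. j < n \<Longrightarrow> \<mu> j \<ge> 0" "(\<Sum>j<n. \<mu> j) = 1" for \<mu> i
  proof -
    have "x i - (\<Sum>j<n. \<mu> j *\<^sub>R x j) = (\<Sum>j<n. \<mu> j *\<^sub>R (x i - x j))"
      using that(2) by (simp add: scaleR_diff_right sum_subtractf scaleR_sum_left[symmetric])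
    also have "norm \<dots> \<le> (\<Sum>j<n. \<mu> j * norm (x i - x j))"
      using that(1) by (intro sum_norm_le) simp
    finally show ?thesis .
  qed
  have le2: "norm (x i - x j) \<le> 2" if "i < n" "j < n" for i j
    using norm_triangle_ineq4[of "x i" "x j"] unit[OF that(1)] unit[OF that(2)] by linarith
  have sep: "norm (x j - x k) \<ge> 2" if jk: "j < n" "k < n" "j \<noteq> k" for j k
  proof (rule ccontr)
    define \<delta> where "\<delta> = 2 - norm (x j - x k)"
    assume "\<not> ?thesis"
    then have \<delta>: "0 < \<delta>" "\<delta> \<le> 2" by (auto simp: \<delta>_def)
    \<comment> \<open>Small enough for the weights to stay nonnegative and for the loss at \<open>j\<close> and
        \<open>k\<close> not to use up the gain \<open>\<delta> / n\<close>.\<close>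
    define \<eta> where "\<eta> = \<delta> / (8 * real n ^ 2)"
    have "\<eta> > 0" using \<delta> n0 by (simp add: \<eta>_def)
    have \<eta>_small: "4 * real n * (real n * \<eta>) = \<delta> / 2"
      using n0 by (simp add: \<eta>_def power2_eq_square)
    define \<mu> where "\<mu> i = (if i = j \<or> i = k then 1 / real n - (real n - 2) * \<eta> else 1 / real n + 2 * \<eta>)" for i
    have "real n * ((real n - 2) * \<eta>) \<le> real n * (real n * \<eta>)"
      using n0 \<open>\<eta> > 0\<close> by simp
    also have "4 * real n * (real n * \<eta>) \<le> 4" using \<eta>_small \<delta> by linarith
    then have "real n * (real n * \<eta>) \<le> 1" by simp
    finally have "(real n - 2) * \<eta> \<le> 1 / real n" using n0 by (simp add: field_simps)
    then have \<mu>_nonneg: "\<mu> i \<ge> 0" for i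
      using n0 \<open>\<eta> > 0\<close> by (simp add: \<mu>_def)
    have "(\<Sum>i<n. \<mu> i) = (\<Sum>i<n. (1 / real n + 2 * \<eta>) - (if i = j then real n * \<eta> else 0)
        - (if i = k then real n * \<eta> else 0))"
      using jk(3) by (intro sum.cong) (auto simp: \<mu>_def algebra_simps)
    also have "\<dots> = 1"
      using n0 jk unfolding sum_subtractf by (simp add: distrib_left)
    finally have \<mu>_sum: "(\<Sum>i<n. \<mu> i) = 1" .
    have rest: "(\<Sum>l\<in>{..<n} - {i}. \<mu> l) = 1 - \<mu> i" if "i < n" for i
      using \<mu>_sum that by (simp add: sum_diff1)
    have below: "(\<Sum>l<n. \<mu> l * norm (x i - x l)) < 2 - 2 / real n" if i: "i < n" for i
    proof -
      have split: "(\<Sum>l<n. \<mu> l * norm (x i - x l)) = (\<Sum>l\<in>{..<n} - {i}. \<mu> l * norm (x i - x l))"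
        using i by (subst sum.remove[of _ i]) auto
      show ?thesis
      proof (cases "i = j \<or> i = k")
        case False
        have "(\<Sum>l\<in>{..<n} - {i}. \<mu> l * norm (x i - x l)) \<le> (\<Sum>l\<in>{..<n} - {i}. \<mu> l * 2)"
          using \<mu>_nonneg le2 i by (intro sum_mono mult_left_mono) auto
        also have "\<dots> = (1 - \<mu> i) * 2"
          using rest[OF i] by (simp add: sum_distrib_right[symmetric])
        also have "\<dots> < 2 - 2 / real n"
          using False \<open>\<eta> > 0\<close> by (simp add: \<mu>_def)
        finally show ?thesis unfolding split .
      next
        case True
        define i' where "i' = (if i = j then k else j)"
        have i': "i' < n" "i' \<noteq> i" "norm (x i - x i') = 2 - \<delta>"
          using True jk by (auto simp: i'_def \<delta>_def norm_minus_commute)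
        have \<mu>_i: "\<mu> i = 1 / real n - (real n - 2) * \<eta>" "\<mu> i' = 1 / real n - (real n - 2) * \<eta>"
          using True by (auto simp: \<mu>_def i'_def)
        have "(\<Sum>l\<in>{..<n} - {i}. \<mu> l * norm (x i - x l))
            \<le> (\<Sum>l\<in>{..<n} - {i}. \<mu> l * 2 - (if l = i' then \<delta> * \<mu> i' else 0))"
        proof (intro sum_mono)
          fix l assume "l \<in> {..<n} - {i}"
          then show "\<mu> l * norm (x i - x l) \<le> \<mu> l * 2 - (if l = i' then \<delta> * \<mu> i' else 0)"
            using mult_left_mono[OF le2[OF i, of l] \<mu>_nonneg[of l]]
            by (cases "l = i'") (simp_all add: i'(3) right_diff_distrib mult.commute)
        qed
        also have "\<dots> = (1 - \<mu> i) * 2 - \<delta> * \<mu> i'"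
          using rest[OF i] i' by (simp add: sum_subtractf sum_distrib_right[symmetric])
        also have "\<dots> = 2 - 2 / real n + ((2 + \<delta>) * ((real n - 2) * \<eta>) - \<delta> / real n)"
          unfolding \<mu>_i by (simp add: algebra_simps)
        also have "(2 + \<delta>) * ((real n - 2) * \<eta>) < \<delta> / real n"
        proof -
          have "(2 + \<delta>) * ((real n - 2) * \<eta>) \<le> 4 * (real n * \<eta>)"
            using \<delta> n0 \<open>\<eta> > 0\<close> by (intro mult_mono) auto
          also have "\<dots> = \<delta> / (2 * real n)"
            using \<eta>_small n0 by (simp add: field_simps)
          also have "\<dots> < \<delta> / real n" using \<delta> n0 by (simp add: field_simps)
          finally show ?thesis .
        qed
        finally show ?thesis unfolding split by simp
      qed
    qed
    then show False
      using far[of \<mu>, OF \<mu>_nonneg \<mu>_sum] dist_le[of \<mu>, OF \<mu>_nonneg \<mu>_sum] by (meson leD order_le_less_trans)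
  qed
  obtain i where i: "i < n" "norm (x i - (\<Sum>j<n. (1 / real n) *\<^sub>R x j)) \<ge> 2 - 2 / real n"
    using far[of "\<lambda>_. 1 / real n"] n0 by auto
  have "card ({..<n} - {i}) \<ge> 2" using n i(1) by simp
  then obtain j k where jk: "j \<in> {..<n} - {i}" "k \<in> {..<n} - {i}" "j \<noteq> k"
    by (metis card_le_Suc0_iff_eq finite_Diff finite_lessThan not_less_eq_eq numeral_2_eq_2)
  let ?R = "{..<n} - {i} - {j} - {k}"
  have "(\<Sum>l<n. x l) = x i + (\<Sum>l\<in>{..<n} - {i}. x l)"
    using i(1) by (intro sum.remove) auto
  also have "(\<Sum>l\<in>{..<n} - {i}. x l) = x j + (\<Sum>l\<in>{..<n} - {i} - {j}. x l)"
    using jk by (intro sum.remove) auto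
  also have "(\<Sum>l\<in>{..<n} - {i} - {j}. x l) = x k + (\<Sum>l\<in>?R. x l)"
    using jk by (intro sum.remove) auto
  finally have total: "(\<Sum>l<n. x l) = x i + (x j + (x k + (\<Sum>l\<in>?R. x l)))" .
  have "card ?R = n - 3" using i(1) jk by simp
  have "real n *\<^sub>R (x i - (\<Sum>l<n. (1 / real n) *\<^sub>R x l)) = real n *\<^sub>R x i - (\<Sum>l<n. x l)"
    using n0 by (simp add: scaleR_diff_right scaleR_sum_right)
  also have "\<dots> = (real n - 1) *\<^sub>R x i - (x j + x k) - (\<Sum>l\<in>?R. x l)"
    unfolding total by (simp add: algebra_simps)
  finally have "real n * norm (x i - (\<Sum>l<n. (1 / real n) *\<^sub>R x l))
      = norm ((real n - 1) *\<^sub>R x i - (x j + x k) - (\<Sum>l\<in>?R. x l))"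
    by (metis abs_of_nat norm_scaleR)
  also have "\<dots> \<le> norm ((real n - 1) *\<^sub>R x i) + norm (x j + x k) + norm (\<Sum>l\<in>?R. x l)"
    by (meson add_right_mono norm_triangle_ineq4 order_trans)
  also have "norm ((real n - 1) *\<^sub>R x i) \<le> real n - 1"
    using unit[OF i(1)] n0 mult_left_mono[of "norm (x i)" 1 "real n - 1"] by simp
  also have "norm (\<Sum>l\<in>?R. x l) \<le> real (card ?R) * 1"
    using unit by (intro sum_norm_bound) auto
  also have "real n * (2 - 2 / real n) \<le> real n * norm (x i - (\<Sum>l<n. (1 / real n) *\<^sub>R x l))"
    using i(2) n0 by (intro mult_left_mono) auto
  finally have "norm (x j + x k) \<ge> 2"
    using n0 n by (simp add: \<open>card ?R = n - 3\<close> of_nat_diff algebra_simps)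
  then show ?thesis
    using that[of j k] sep[of j k] jk by auto
qed

lemma rel_proj_const_eq_1:
  fixes Z :: "'a::real_normed_vector set"
  assumes "is_projection_onto P Z" and "onorm P \<le> 1" and "z \<in> Z" "z \<noteq> 0"
  shows "rel_proj_const Z = 1"
proof -
  have ge: "onorm Q \<ge> 1" if "is_projection_onto Q Z" for Q
  proof -
    have "bounded_linear Q" "Q z = z" using that assms(3) by (auto simp: is_projection_onto_def)
    then have "norm z \<le> onorm Q * norm z" using onorm[of Q z] by simp
    then show ?thesis using \<open>z \<noteq> 0\<close> by simp
  qed
  then have "onorm P = 1" using assms(1,2) by (simp add: antisym)
  then show ?thesis
    unfolding rel_proj_const_def using assms(1) ge
    by (intro cInf_eq_minimum) (auto intro!: image_eqI[where x=P])
qed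

text \<open>
  If \<open>u\<close>, \<open>v\<close> are in the unit ball and \<open>u \<plusminus> v\<close> have norm 2, then the span of \<open>u\<close>, \<open>v\<close> is isometric to the
  plane with the sum norm, hence also to the one with the maximum norm, and the latter is complemented
  by a projection of norm 1 in every larger space: the coordinates \<open>g\<close>, \<open>h\<close> along \<open>(u - v) / 2\<close> and
  \<open>(u + v) / 2\<close> are norm-1 functionals on the plane and extend without increase of norm.
  A norming functional \<open>g\<close> of \<open>u - v\<close> is automatically such an extension, since it must take the
  values \<open>1\<close> and \<open>-1\<close> at \<open>u\<close> and \<open>v\<close>; likewise for \<open>h\<close> and \<open>u + v\<close>.
\<close>

lemma one_complemented_plane:
  fixes B :: "'a::real_normed_vector set" and u v :: 'a
  assumes fin: "finite B" and ind: "independent B" and span: "span B = UNIV"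
    and unit: "norm u \<le> 1" "norm v \<le> 1" and diag: "norm (u - v) \<ge> 2" "norm (u + v) \<ge> 2"
  shows "dim (span {u, v}) = 2" and "rel_proj_const (span {u, v}) = 1"
proof -
  obtain g :: "'a \<Rightarrow> real" where g: "linear g" "g (u - v) = norm (u - v)" "\<And>y. \<bar>g y\<bar> \<le> norm y"
    using norming_functional_finite_dim[OF fin span, of "u - v"] by blast
  obtain h :: "'a \<Rightarrow> real" where h: "linear h" "h (u + v) = norm (u + v)" "\<And>y. \<bar>h y\<bar> \<le> norm y"
    using norming_functional_finite_dim[OF fin span, of "u + v"] by blast
  interpret g: linear g by fact
  interpret h: linear h by fact
  have guv: "g u = 1" "g v = -1"
    using g(2) g(3)[of u] g(3)[of v] unit diag by (auto simp: g.diff)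
  have huv: "h u = 1" "h v = 1"
    using h(2) h(3)[of u] h(3)[of v] unit diag by (auto simp: h.add)
  have "u \<noteq> v" using guv by auto
  have "independent {u, v}"
  proof -
    have "v \<noteq> 0" using huv h.zero by auto
    moreover have "u \<notin> span {v}"
    proof
      assume "u \<in> span {v}"
      then obtain c where "u = c *\<^sub>R v" by (auto simp: span_singleton)
      then show False using guv huv by (auto simp: g.scale h.scale h.neg)
    qed
    ultimately show ?thesis using \<open>u \<noteq> v\<close> by (simp add: independent_insert)
  qed
  then show "dim (span {u, v}) = 2"
    using dim_span_eq_card_independent[of "{u, v}"] \<open>u \<noteq> v\<close> by simp
  define P where "P x = ((h x + g x) / 2) *\<^sub>R u + ((h x - g x) / 2) *\<^sub>R v" for x
  have "linear P"
    by (rule linearI) (simp_all add: P_def g.add g.scale h.add h.scale algebra_simps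
        add_divide_distrib diff_divide_distrib)
  then have bl: "bounded_linear P" by (rule bounded_linear_finite_dim[OF fin ind span])
  have "P u = u" "P v = v" using guv huv by (simp_all add: P_def)
  then have "P x = id x" if "x \<in> span {u, v}" for x
    by (intro linear_eq_on_span[OF \<open>linear P\<close> linear_id _ that]) auto
  moreover have "P x \<in> span {u, v}" for x
    unfolding P_def by (intro span_add span_scale span_base) auto
  ultimately have proj: "is_projection_onto P (span {u, v})"
    using bl by (auto simp: is_projection_onto_def)
  have "norm (P x) \<le> 1 * norm x" for x
  proof -
    have "norm (P x) \<le> \<bar>(h x + g x) / 2\<bar> * norm u + \<bar>(h x - g x) / 2\<bar> * norm v"
      unfolding P_def by (metis norm_scaleR norm_triangle_ineq)
    also have "\<dots> \<le> \<bar>(h x + g x) / 2\<bar> * 1 + \<bar>(h x - g x) / 2\<bar> * 1"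
      using unit by (intro add_mono mult_left_mono) auto
    also have "\<dots> \<le> max \<bar>g x\<bar> \<bar>h x\<bar>" by (auto simp: abs_if max_def field_simps)
    also have "\<dots> \<le> norm x" using g(3) h(3) by simp
    finally show ?thesis by simp
  qed
  then have "onorm P \<le> 1" by (intro onorm_bound) auto
  moreover have "u \<noteq> 0" using guv g.zero by auto
  ultimately show "rel_proj_const (span {u, v}) = 1"
    using rel_proj_const_eq_1[OF proj, of u] by (simp add: span_base)
qed

section \<open>Hyperplanes with maximal projection constant\<close>

lemma hyperplane_eq_kernel:
  fixes Y :: "'a::real_vector set"
  assumes fin: "finite B" and ind: "independent B" and span: "span B = (UNIV :: 'a set)"
    and Y: "subspace Y" and "Suc (dim Y) = card B"
  obtains f :: "'a \<Rightarrow> real" and a where "linear f" "f a = 1" "Y = {x. f x = 0}"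
proof -
  obtain C where C: "C \<subseteq> Y" "independent C" "Y \<subseteq> span C" and cardC: "card C = dim Y"
    by (rule basis_exists[of Y])
  have spanC: "span C = Y" using C Y by (metis span_minimal subset_antisym)
  have small: "finite D \<and> card D \<le> card B" if "independent D" for D :: "'a set"
    using independent_span_bound[OF fin that] span by auto
  have "Y \<noteq> UNIV"
  proof
    assume "Y = UNIV"
    then have "card B \<le> card C"
      using independent_span_bound[OF _ ind, of C] small[OF C(2)] spanC by auto
    then show False using assms(5) cardC by simp
  qed
  then obtain a where "a \<notin> Y" by blast
  then have "a \<notin> C" using C(1) by blast
  then have aC: "independent (insert a C)" "card (insert a C) = card B"
    using C(2) spanC \<open>a \<notin> Y\<close> small[OF C(2)] assms(5) cardC by (simp_all add: independent_insert)
  have full: "x \<in> span (insert a C)" for x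
  proof (rule ccontr)
    assume x: "x \<notin> span (insert a C)"
    then have "independent (insert x (insert a C))" using aC(1) by (simp add: independent_insert)
    then have "card (insert x (insert a C)) \<le> card B" using small by blast
    moreover have "x \<notin> insert a C" using x span_base by metis
    moreover have "finite (insert a C)" using small[OF aC(1)] by (rule conjunct1)
    ultimately have "Suc (card (insert a C)) \<le> card B"
      by (metis card_insert_disjoint)
    then show False using aC(2) by simp
  qed
  obtain f :: "'a \<Rightarrow> real" where f: "linear f" "f a = 1" "\<And>x. x \<in> Y \<Longrightarrow> f x = 0"
    by (rule functional_vanishing_on_subspace[OF Y \<open>a \<notin> Y\<close>]) (rule that)
  have "x \<in> Y" if "f x = 0" for x
  proof -
    have "\<exists>k. x - k *\<^sub>R a \<in> Y"
      using full[of x] unfolding span_breakdown_eq spanC .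
    then obtain k where k: "x - k *\<^sub>R a \<in> Y" ..
    have "k = 0"
      using f(3)[OF k] that f(2) by (simp add: linear_diff[OF f(1)] linear_cmul[OF f(1)])
    then show ?thesis using k by simp
  qed
  then have "Y = {x. f x = 0}" using f(3) by auto
  then show ?thesis by (rule that[OF f(1,2)])
qed

theorem corollary2p6:
  fixes Y :: "'a::real_normed_vector set" and n :: nat
  assumes "n \<ge> 3"
    and "dim (UNIV :: 'a set) = n"
    and "subspace Y"
    and "dim Y = n - 1"
    and "rel_proj_const Y = 2 - 2 / real n"
  shows "\<exists>Z :: 'a set. subspace Z \<and> dim Z = 2 \<and> rel_proj_const Z = 1"
proof -
  obtain B :: "'a set" where ind: "independent B" and "UNIV \<subseteq> span B" and "card B = dim (UNIV :: 'a set)"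
    by (rule basis_exists[of "UNIV :: 'a set"])
  then have span: "span B = UNIV" and card: "card B = n" using assms(2) by auto
  have fin: "finite B" using card assms(1) card_ge_0_finite by force
  obtain f :: "'a \<Rightarrow> real" and a where f: "linear f" "f a = 1" and Y: "Y = {x. f x = 0}"
    using hyperplane_eq_kernel[OF fin ind span assms(3)] assms(1,4) card by auto
  have bf: "bounded_linear f" by (rule bounded_linear_finite_dim[OF fin ind span f(1)])
  interpret f: bounded_linear f by fact
  obtain x :: "nat \<Rightarrow> 'a" where unit: "\<And>i. norm (x i) \<le> 1" and nonneg: "\<And>i. f (x i) \<ge> 0"
    and far: "\<And>w. f w = 1 \<Longrightarrow> \<exists>i<n. norm (x i - f (x i) *\<^sub>R w) \<ge> 2 - 2 / real n"
    using extremal_tuple[OF fin ind span card bf, of a] f(2) assms(5) Y by (metis zero_neq_one)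
  have big: "2 - 2 / real n > 1" using assms(1) by (simp add: field_simps)
  have ex_pos: "\<exists>i\<in>{..<n}. f (x i) > 0"
  proof (rule ccontr)
    assume "\<not> ?thesis"
    then have "f (x i) = 0" if "i < n" for i using nonneg[of i] that by force
    then obtain i where "norm (x i) \<ge> 2 - 2 / real n" using far[OF f(2)] by auto
    then show False using unit[of i] big by linarith
  qed
  \<comment> \<open>Test the extremal tuple against vectors \<open>w\<close> in its own convex cone; there the triangle
      inequality alone bounds the displacement.\<close>
  have unbalanced: "\<exists>i\<in>{..<n}. f (x i) * ((\<Sum>j<n. p j) - 2 * p i) \<ge> 1 - 2 / real n"
    if p: "\<And>i. i \<in> {..<n} \<Longrightarrow> p i \<ge> 0" "(\<Sum>i<n. p i * f (x i)) = 1" for p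
  proof -
    define w where "w = (\<Sum>j<n. p j *\<^sub>R x j)"
    have "f w = 1" using p(2) by (simp add: w_def f.sum f.scaleR)
    then obtain i where i: "i < n" "norm (x i - f (x i) *\<^sub>R w) \<ge> 2 - 2 / real n"
      using far by blast
    have rest: "(\<Sum>j<n. q j) = q i + (\<Sum>j\<in>{..<n} - {i}. q j)" for q :: "nat \<Rightarrow> 'b::comm_monoid_add"
      using i(1) by (intro sum.remove) auto
    have "p i * f (x i) \<le> 1"
      using member_le_sum[of i "{..<n}" "\<lambda>i. p i * f (x i)"] p i(1) nonneg by simp
    have "x i - f (x i) *\<^sub>R w = (1 - p i * f (x i)) *\<^sub>R x i - f (x i) *\<^sub>R (\<Sum>j\<in>{..<n} - {i}. p j *\<^sub>R x j)"
      unfolding w_def rest[of "\<lambda>j. p j *\<^sub>R x j"] by (simp add: algebra_simps)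
    also have "norm \<dots> \<le> norm ((1 - p i * f (x i)) *\<^sub>R x i) + norm (f (x i) *\<^sub>R (\<Sum>j\<in>{..<n} - {i}. p j *\<^sub>R x j))"
      by (rule norm_triangle_ineq4)
    also have "norm ((1 - p i * f (x i)) *\<^sub>R x i) \<le> 1 - p i * f (x i)"
      using mult_left_mono[OF unit[of i], of "1 - p i * f (x i)"] \<open>p i * f (x i) \<le> 1\<close> by simp
    also have "norm (f (x i) *\<^sub>R (\<Sum>j\<in>{..<n} - {i}. p j *\<^sub>R x j)) \<le> f (x i) * (\<Sum>j\<in>{..<n} - {i}. p j)"
    proof -
      have "norm (\<Sum>j\<in>{..<n} - {i}. p j *\<^sub>R x j) \<le> (\<Sum>j\<in>{..<n} - {i}. p j)"
        using p(1) unit by (intro sum_norm_le) (simp add: mult_left_le)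
      then show ?thesis using nonneg[of i] by (simp add: mult_left_mono)
    qed
    finally have "2 - 2 / real n \<le> 1 - p i * f (x i) + f (x i) * ((\<Sum>j<n. p j) - p i)"
      using i(2) rest[of p] by simp
    then have "f (x i) * ((\<Sum>j<n. p j) - 2 * p i) \<ge> 1 - 2 / real n"
      by (simp add: algebra_simps)
    then show ?thesis using i(1) by blast
  qed
  have "\<exists>s>0. \<forall>i\<in>{..<n}. f (x i) = s"
  proof (rule equal_heights_of_unbalanced[OF finite_lessThan card_lessThan assms(1)])
    show "\<exists>i\<in>{..<n}. f (x i) * ((\<Sum>j<n. p j) - 2 * p i) \<ge> 1 - 2 / real n"
      if "\<And>i. i \<in> {..<n} \<Longrightarrow> p i \<ge> 0" "(\<Sum>i<n. p i * f (x i)) = 1" for p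
      using that by (rule unbalanced)
  qed (rule nonneg ex_pos)+
  then obtain s where s: "s > 0" "\<And>i. i < n \<Longrightarrow> f (x i) = s"
    by auto
  \<comment> \<open>At common height \<open>s\<close>, the displacement \<open>x i - f (x i) *\<^sub>R w\<close> is the
      difference of \<open>x i\<close> and the point \<open>s *\<^sub>R w\<close> of the same height.\<close>
  have "\<exists>i<n. norm (x i - (\<Sum>j<n. \<mu> j *\<^sub>R x j)) \<ge> 2 - 2 / real n"
    if "(\<Sum>i<n. \<mu> i) = 1" for \<mu>
  proof -
    have "f (\<Sum>j<n. \<mu> j *\<^sub>R x j) = s"
      using s(2) that by (simp add: f.sum f.scaleR sum_distrib_right[symmetric])
    then have "f ((1 / s) *\<^sub>R (\<Sum>j<n. \<mu> j *\<^sub>R x j)) = 1"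
      using s(1) by (simp add: f.scaleR)
    from far[OF this] show ?thesis using s by auto
  qed
  then obtain j k where "norm (x j - x k) \<ge> 2" "norm (x j + x k) \<ge> 2"
    using long_sum_and_difference[OF assms(1), of x] unit by metis
  then show ?thesis
    using one_complemented_plane[OF fin ind span unit[of j] unit[of k]] subspace_span by blast
qed

end
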